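(* Let $M=\mathrm{Span}\{e_{11},e_{12},e_{13},e_{23},e_{22}+e_{33}\}\subset M_3(\mathbb{C})$. The following seven subalgebras of $M_3(\mathbb{C})$ lie in pairwise different orbits under the action of automorphisms and antiautomorphisms of $M_3(\mathbb{C})$ preserving $M$; that is, for any two distinct subalgebras $S,S'$ in the list there is no automorphism or antiautomorphism $\varphi$ of $M_3(\mathbb{C})$ with $\varphi(M)=M$ and $\varphi(S)=S'$: (X1) $\mathrm{Span}\{e_{21},e_{22},e_{31},e_{32}\}$; (X2) $\mathrm{Span}\{e_{21},e_{31},e_{32},e_{33}\}$; (X3) $\mathrm{Span}\{e_{21},e_{31},e_{32},e_{11}+e_{22}\}$; (X4) $\mathrm{Span}\{e_{21},e_{31},e_{32},e_{11}+e_{33}\}$; (X5) $\mathrm{Span}\{e_{11}+e_{31},e_{12}+e_{32},e_{21},e_{22}\}$; (X6) $\mathrm{Span}\{e_{21}+e_{12},e_{31},e_{32},e_{11}+e_{22}\}$; (X7) $\mathrm{Span}\{e_{21}+e_{22},e_{31},e_{32},e_{33}\}$.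
   Context: $M_3(\mathbb{C})$ is the algebra of $3\times3$ complex matrices, $e_{ij}$ are the matrix units, and $\mathrm{Span}$ means linear span over $\mathbb{C}$. An automorphism is a $\mathbb{C}$-algebra automorphism of $M_3(\mathbb{C})$; an antiautomorphism is the composition of an automorphism and the transpose map. *)

theory Defs
  imports "HOL-Analysis.Analysis"
begin

type_synonym cmat3 = "complex ^ 3 ^ 3"

text \<open>HOL-Analysis equips \<open>complex ^ 3 ^ 3\<close> only with real scalar multiplication
  (and with \<open>*s\<close>, whose scalars are the rows), so the complex vector space structure
  is set up here. \<open>cmat.span\<close> and \<open>cmat.subspace\<close> are over the complex numbers.\<close>

definition cscale :: "complex \<Rightarrow> cmat3 \<Rightarrow> cmat3" (infixr \<open>*\<^sub>m\<close> 75)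
  where "c *\<^sub>m A = (\<chi> i j. c * A $ i $ j)"

global_interpretation cmat: vector_space cscale
  by unfold_locales (simp_all add: cscale_def vec_eq_iff algebra_simps)

definition mat_unit :: "3 \<Rightarrow> 3 \<Rightarrow> cmat3"
  where "mat_unit i j = (\<chi> k l. if k = i \<and> l = j then 1 else 0)"

text \<open>In the index type \<open>3\<close> the numerals are taken modulo 3, so that
  \<open>1\<close>, \<open>2\<close>, \<open>3\<close> are its three elements (and \<open>3 = 0\<close>).\<close>

abbreviation "e11 \<equiv> mat_unit 1 1"
abbreviation "e12 \<equiv> mat_unit 1 2"
abbreviation "e13 \<equiv> mat_unit 1 3"
abbreviation "e21 \<equiv> mat_unit 2 1"
abbreviation "e22 \<equiv> mat_unit 2 2"
abbreviation "e23 \<equiv> mat_unit 2 3"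
abbreviation "e31 \<equiv> mat_unit 3 1"
abbreviation "e32 \<equiv> mat_unit 3 2"
abbreviation "e33 \<equiv> mat_unit 3 3"

text \<open>Subalgebras need not contain the identity matrix: none of the subalgebras below does.\<close>

definition subalgebra :: "cmat3 set \<Rightarrow> bool"
  where "subalgebra S \<longleftrightarrow> cmat.subspace S \<and> (\<forall>A\<in>S. \<forall>B\<in>S. A ** B \<in> S)"

definition automorphism :: "(cmat3 \<Rightarrow> cmat3) \<Rightarrow> bool"
  where "automorphism \<phi> \<longleftrightarrow>
    bij \<phi> \<and> Vector_Spaces.linear cscale cscale \<phi> \<and>
    (\<forall>A B. \<phi> (A ** B) = \<phi> A ** \<phi> B) \<and> \<phi> (mat 1) = mat 1"

definition antiautomorphism :: "(cmat3 \<Rightarrow> cmat3) \<Rightarrow> bool"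
  where "antiautomorphism \<phi> \<longleftrightarrow> (\<exists>\<psi>. automorphism \<psi> \<and> \<phi> = \<psi> \<circ> transpose)"

definition M :: "cmat3 set"
  where "M = cmat.span {e11, e12, e13, e23, e22 + e33}"

definition same_orbit :: "cmat3 set \<Rightarrow> cmat3 set \<Rightarrow> bool"
  where "same_orbit S S' \<longleftrightarrow>
    (\<exists>\<phi>. (automorphism \<phi> \<or> antiautomorphism \<phi>) \<and> \<phi> ` M = M \<and> \<phi> ` S = S')"

definition X1 :: "cmat3 set" where "X1 = cmat.span {e21, e22, e31, e32}"
definition X2 :: "cmat3 set" where "X2 = cmat.span {e21, e31, e32, e33}"
definition X3 :: "cmat3 set" where "X3 = cmat.span {e21, e31, e32, e11 + e22}"
definition X4 :: "cmat3 set" where "X4 = cmat.span {e21, e31, e32, e11 + e33}"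
definition X5 :: "cmat3 set" where "X5 = cmat.span {e11 + e31, e12 + e32, e21, e22}"
definition X6 :: "cmat3 set" where "X6 = cmat.span {e21 + e12, e31, e32, e11 + e22}"
definition X7 :: "cmat3 set" where "X7 = cmat.span {e21 + e22, e31, e32, e33}"

definition X_list :: "cmat3 set list"
  where "X_list = [X1, X2, X3, X4, X5, X6, X7]"

end

theory Submission
  imports Defs
begin

text \<open>The seven subalgebras are already pairwise different as abstract algebras: no two of them are
  isomorphic or anti-isomorphic. So it is enough to find properties that can be
  phrased with the elements and products of \<open>S\<close> alone and that do not change when the product is
  reversed; every automorphism or antiautomorphism of the matrix algebra transports
  them from \<open>S\<close> to its image.

  The algebras \<open>X1\<close>, ..., \<open>X4\<close> consist of the strictly lower triangular matrices together with one
  diagonal idempotent, \<open>X5\<close> is isomorphic to the algebra of \<open>2 \<times> 2\<close> matrices, and \<open>X6\<close>, \<open>X7\<close> have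
  the radical \<open>Span {e31, e32}\<close>, of square zero, with quotient \<open>\<complex> \<times> \<complex>\<close>. They are told apart by four
  properties.

  \<^item> Two elements of square zero have a nonzero product: true for \<open>X1\<close>, ..., \<open>X5\<close>, where
    \<open>e32 ** e21 = e31\<close> or its analogue for \<open>2 \<times> 2\<close> matrices is available, and false for \<open>X6\<close> and
    \<open>X7\<close>, where all such elements lie in the radical.

  \<^item> Some nonzero element of square zero is fixed by one element \<open>e\<close> from both sides: true for
    \<open>X3\<close>, \<open>X4\<close>, \<open>X5\<close>, \<open>X7\<close> and false for \<open>X1\<close>, \<open>X2\<close>, \<open>X6\<close>.

  \<^item> The left and the right annihilator of the algebra are both zero or both nonzero: true for
    \<open>X1\<close>, \<open>X4\<close>, \<open>X5\<close> and false for \<open>X2\<close>, \<open>X3\<close>, \<open>X6\<close>, \<open>X7\<close>.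

  \<^item> There is an identity element: true for \<open>X5\<close> and false for \<open>X4\<close>, the only two that the first
    three properties do not separate.

  Each value comes from an explicit witness, or from solving the few polynomial equations that the
  product imposes on the matrix entries.\<close>

section \<open>The subalgebras in coordinates\<close>

lemma cscale_nth: "(c *\<^sub>m A) $ i $ j = c * A $ i $ j"
  by (simp add: cscale_def)

lemma mat_unit_nth: "mat_unit i j $ k $ l = (if k = i \<and> l = j then 1 else 0)"
  by (simp add: mat_unit_def)

lemma mat_mult_nth:
  fixes A B :: cmat3
  shows "(A ** B) $ i $ j = A $ i $ 1 * B $ 1 $ j + A $ i $ 2 * B $ 2 $ j + A $ i $ 3 * B $ 3 $ j"
  by (simp add: matrix_matrix_mult_def sum_3)

lemma cmat3_eq_iff: "A = B \<longleftrightarrow> (\<forall>i j. A $ i $ j = B $ i $ j)" for A B :: cmat3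
  by (simp add: vec_eq_iff)

lemma mem_span4_iff:
  "x \<in> cmat.span {A, B, C, D} \<longleftrightarrow>
    (\<exists>a b c d. x = a *\<^sub>m A + b *\<^sub>m B + c *\<^sub>m C + d *\<^sub>m D)"
  by (simp add: cmat.span_insert cmat.span_empty algebra_simps)

lemmas entry_simps = cmat3_eq_iff forall_3 cscale_nth mat_unit_nth mat_mult_nth

lemma mem_X1_iff: "x \<in> X1 \<longleftrightarrow>
    x $ 1 $ 1 = 0 \<and> x $ 1 $ 2 = 0 \<and> x $ 1 $ 3 = 0 \<and> x $ 2 $ 3 = 0 \<and> x $ 3 $ 3 = 0"
  unfolding X1_def mem_span4_iff by (auto simp: entry_simps)

lemma mem_X2_iff: "x \<in> X2 \<longleftrightarrow>
    x $ 1 $ 1 = 0 \<and> x $ 1 $ 2 = 0 \<and> x $ 1 $ 3 = 0 \<and> x $ 2 $ 2 = 0 \<and> x $ 2 $ 3 = 0"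
  unfolding X2_def mem_span4_iff by (auto simp: entry_simps)

lemma mem_X3_iff: "x \<in> X3 \<longleftrightarrow>
    x $ 1 $ 2 = 0 \<and> x $ 1 $ 3 = 0 \<and> x $ 2 $ 2 = x $ 1 $ 1 \<and> x $ 2 $ 3 = 0 \<and> x $ 3 $ 3 = 0"
  unfolding X3_def mem_span4_iff by (auto simp: entry_simps)

lemma mem_X4_iff: "x \<in> X4 \<longleftrightarrow>
    x $ 1 $ 2 = 0 \<and> x $ 1 $ 3 = 0 \<and> x $ 2 $ 2 = 0 \<and> x $ 2 $ 3 = 0 \<and> x $ 3 $ 3 = x $ 1 $ 1"
  unfolding X4_def mem_span4_iff by (auto simp: entry_simps)

lemma mem_X5_iff: "x \<in> X5 \<longleftrightarrow>
    x $ 1 $ 3 = 0 \<and> x $ 2 $ 3 = 0 \<and> x $ 3 $ 1 = x $ 1 $ 1 \<and> x $ 3 $ 2 = x $ 1 $ 2 \<and> x $ 3 $ 3 = 0"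
  unfolding X5_def mem_span4_iff by (auto simp: entry_simps)

lemma mem_X6_iff: "x \<in> X6 \<longleftrightarrow>
    x $ 1 $ 3 = 0 \<and> x $ 2 $ 1 = x $ 1 $ 2 \<and> x $ 2 $ 2 = x $ 1 $ 1 \<and> x $ 2 $ 3 = 0 \<and> x $ 3 $ 3 = 0"
  unfolding X6_def mem_span4_iff by (auto simp: entry_simps)

lemma mem_X7_iff: "x \<in> X7 \<longleftrightarrow>
    x $ 1 $ 1 = 0 \<and> x $ 1 $ 2 = 0 \<and> x $ 1 $ 3 = 0 \<and> x $ 2 $ 2 = x $ 2 $ 1 \<and> x $ 2 $ 3 = 0"
  unfolding X7_def mem_span4_iff by (auto simp: entry_simps)

lemmas mem_X_iffs = mem_X1_iff mem_X2_iff mem_X3_iff mem_X4_iff mem_X5_iff mem_X6_iff mem_X7_iff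

lemma subalgebra_X: "\<forall>S \<in> set X_list. subalgebra S"
  unfolding X_list_def subalgebra_def cmat.subspace_def
  by (simp add: mem_X_iffs cscale_nth mat_mult_nth algebra_simps)

section \<open>Invariants of algebras up to isomorphism and anti-isomorphism\<close>

definition has_corner_square_zero :: "cmat3 set \<Rightarrow> bool"
  where "has_corner_square_zero S \<longleftrightarrow>
    (\<exists>e\<in>S. \<exists>x\<in>S. x \<noteq> 0 \<and> x ** x = 0 \<and> e ** x = x \<and> x ** e = x)"

definition has_square_zero_pair :: "cmat3 set \<Rightarrow> bool"
  where "has_square_zero_pair S \<longleftrightarrow>
    (\<exists>x\<in>S. \<exists>y\<in>S. x ** x = 0 \<and> y ** y = 0 \<and> x ** y \<noteq> 0)"

definition has_left_annihilator :: "cmat3 set \<Rightarrow> bool"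
  where "has_left_annihilator S \<longleftrightarrow> (\<exists>x\<in>S. x \<noteq> 0 \<and> (\<forall>y\<in>S. x ** y = 0))"

definition has_right_annihilator :: "cmat3 set \<Rightarrow> bool"
  where "has_right_annihilator S \<longleftrightarrow> (\<exists>x\<in>S. x \<noteq> 0 \<and> (\<forall>y\<in>S. y ** x = 0))"

text \<open>Passing to the opposite algebra exchanges the two annihilators, so neither is an invariant by
  itself, but the comparison of the two is.\<close>

definition balanced :: "cmat3 set \<Rightarrow> bool"
  where "balanced S \<longleftrightarrow> (has_left_annihilator S \<longleftrightarrow> has_right_annihilator S)"

definition unital :: "cmat3 set \<Rightarrow> bool"
  where "unital S \<longleftrightarrow> (\<exists>u\<in>S. \<forall>x\<in>S. u ** x = x \<and> x ** u = x)"

definition invariants :: "cmat3 set \<Rightarrow> bool \<times> bool \<times> bool \<times> bool"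
  where "invariants S =
    (has_corner_square_zero S, has_square_zero_pair S, balanced S, unital S)"

lemma automorphism_eq_iff: "automorphism \<phi> \<Longrightarrow> \<phi> A = \<phi> B \<longleftrightarrow> A = B"
  by (simp add: automorphism_def bij_def inj_eq)

lemma automorphism_mult: "automorphism \<phi> \<Longrightarrow> \<phi> A ** \<phi> B = \<phi> (A ** B)"
  by (simp add: automorphism_def)

lemma automorphism_zero_iff:
  assumes "automorphism \<phi>"
  shows "\<phi> A = 0 \<longleftrightarrow> A = 0"
proof -
  have "\<phi> 0 = 0"
    using assms module_hom.zero[of cscale cscale \<phi>]
    by (simp add: automorphism_def module_hom_iff_linear)
  then show ?thesis
    using automorphism_eq_iff[OF assms, of A 0] by simp
qed

text \<open>An injective multiplicative map that preserves zero transports each equation and each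
  inequation in the four definitions.\<close>

lemma invariants_automorphism:
  assumes "automorphism \<phi>"
  shows "invariants (\<phi> ` S) = invariants S"
  unfolding invariants_def has_corner_square_zero_def has_square_zero_pair_def balanced_def
    has_left_annihilator_def has_right_annihilator_def unital_def
  by (simp add: automorphism_mult[OF assms] automorphism_eq_iff[OF assms]
      automorphism_zero_iff[OF assms])

text \<open>Reversing the product swaps the two factors of the square-zero pair, the two equations for
  \<open>e\<close> and for the identity, and the two annihilators; each property as a whole is symmetric.\<close>

lemma invariants_transpose: "invariants (transpose ` S) = invariants S"
proof -
  have mult: "transpose A ** transpose B = transpose (B ** A)" for A B :: cmat3
    by (simp add: matrix_transpose_mul)
  have eq: "transpose A = transpose B \<longleftrightarrow> A = B" for A B :: cmat3
    by (simp add: transpose_iff)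
  have zero: "transpose A = 0 \<longleftrightarrow> A = 0" for A :: cmat3
    by (auto simp: entry_simps transpose_def)
  show ?thesis
    unfolding invariants_def has_corner_square_zero_def has_square_zero_pair_def balanced_def
      has_left_annihilator_def has_right_annihilator_def unital_def
    by (simp add: mult eq zero) blast
qed

lemma invariants_same_orbit:
  assumes "same_orbit S S'"
  shows "invariants S' = invariants S"
proof -
  obtain \<phi> where \<phi>: "automorphism \<phi> \<or> antiautomorphism \<phi>" and S': "S' = \<phi> ` S"
    using assms by (auto simp: same_orbit_def)
  show ?thesis
  proof (cases "automorphism \<phi>")
    case True
    then show ?thesis
      by (simp add: S' invariants_automorphism)
  next
    case False
    then obtain \<psi> where "automorphism \<psi>" and "\<phi> = \<psi> \<circ> transpose"
      using \<phi> by (auto simp: antiautomorphism_def)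
    then show ?thesis
      by (simp only: S' image_comp[symmetric] invariants_automorphism invariants_transpose)
  qed
qed

section \<open>Values of the invariants\<close>

lemmas mem_X_simps = mem_X_iffs entry_simps

text \<open>Two test elements \<open>b\<close> and \<open>c\<close> are enough for all the algebras below. When the algebra has a
  one-sided identity on the relevant side, that element alone serves as both.\<close>

lemma no_left_annihilatorI:
  assumes "b \<in> S" and "c \<in> S" and "\<And>x. x \<in> S \<Longrightarrow> x ** b = 0 \<Longrightarrow> x ** c = 0 \<Longrightarrow> x = 0"
  shows "\<not> has_left_annihilator S"
  using assms unfolding has_left_annihilator_def by blast

lemma no_right_annihilatorI:
  assumes "b \<in> S" and "c \<in> S" and "\<And>x. x \<in> S \<Longrightarrow> b ** x = 0 \<Longrightarrow> c ** x = 0 \<Longrightarrow> x = 0"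
  shows "\<not> has_right_annihilator S"
  using assms unfolding has_right_annihilator_def by blast

lemma unital_imp_balanced:
  assumes "unital S"
  shows "balanced S"
  using assms unfolding unital_def balanced_def has_left_annihilator_def has_right_annihilator_def
  by metis

text \<open>For \<open>e\<close> one takes the diagonal idempotent in \<open>X3\<close> and \<open>X4\<close>, the identity in \<open>X5\<close>, and the
  left identity \<open>e21 + e22 + e33\<close> in \<open>X7\<close>, which fixes exactly the multiples of \<open>e31 + e32\<close>
  in the radical from the right.\<close>

lemma corner_X:
  "has_corner_square_zero X3" "has_corner_square_zero X4" "has_corner_square_zero X5"
  "has_corner_square_zero X7"
  unfolding has_corner_square_zero_def
  subgoal by (rule bexI[of _ "e11 + e22"], rule bexI[of _ e21]) (auto simp: mem_X_simps)
  subgoal by (rule bexI[of _ "e11 + e33"], rule bexI[of _ e31]) (auto simp: mem_X_simps)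
  subgoal by (rule bexI[of _ "e11 + e31 + e22"], rule bexI[of _ e21]) (auto simp: mem_X_simps)
  subgoal by (rule bexI[of _ "e21 + e22 + e33"], rule bexI[of _ "e31 + e32"]) (auto simp: mem_X_simps)
  done

text \<open>The upper left block of \<open>x\<close> has rows \<open>(a, b)\<close> and \<open>(b, a)\<close>, hence eigenvalues \<open>a + b\<close> and
  \<open>a - b\<close>; both vanish when the square of \<open>x\<close> is zero. So \<open>x\<close> lies in \<open>Span {e31, e32}\<close>, which
  every element of \<open>X6\<close> annihilates from the left.\<close>

lemma X6_mult_square_zero:
  assumes "x \<in> X6" and "x ** x = 0" and "y \<in> X6"
  shows "y ** x = 0"
proof -
  let ?a = "x $ 1 $ 1" and ?b = "x $ 1 $ 2"
  have "?a * ?a + ?b * ?b = 0" "?a * ?b + ?b * ?a = 0"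
    using assms(1,2) by (simp_all add: mem_X_simps)
  then have "?a = 0" "?b = 0"
    by auto
  then show ?thesis
    using assms(1,3) by (simp add: mem_X_simps)
qed

lemma not_corner_X:
  "\<not> has_corner_square_zero X1" "\<not> has_corner_square_zero X2" "\<not> has_corner_square_zero X6"
  unfolding has_corner_square_zero_def
  subgoal by (auto simp: mem_X_simps)
  subgoal by (auto simp: mem_X_simps)
  subgoal using X6_mult_square_zero by metis
  done

lemma pair_X:
  "has_square_zero_pair X1" "has_square_zero_pair X2" "has_square_zero_pair X3"
  "has_square_zero_pair X4" "has_square_zero_pair X5"
  unfolding has_square_zero_pair_def
  subgoal by (rule bexI[of _ e32], rule bexI[of _ e21]) (auto simp: mem_X_simps)
  subgoal by (rule bexI[of _ e32], rule bexI[of _ e21]) (auto simp: mem_X_simps)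
  subgoal by (rule bexI[of _ e32], rule bexI[of _ e21]) (auto simp: mem_X_simps)
  subgoal by (rule bexI[of _ e32], rule bexI[of _ e21]) (auto simp: mem_X_simps)
  subgoal by (rule bexI[of _ "e12 + e32"], rule bexI[of _ e21]) (auto simp: mem_X_simps)
  done

lemma not_pair_X:
  "\<not> has_square_zero_pair X6" "\<not> has_square_zero_pair X7"
  unfolding has_square_zero_pair_def
  subgoal using X6_mult_square_zero by blast
  subgoal by (auto simp: mem_X_simps)
  done

lemma left_X: "has_left_annihilator X1" "has_left_annihilator X2" "has_left_annihilator X7"
  unfolding has_left_annihilator_def
  by (rule bexI[of _ e31]; simp add: mem_X_simps)+

lemma right_X: "has_right_annihilator X1" "has_right_annihilator X3" "has_right_annihilator X6"
  unfolding has_right_annihilator_def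
  subgoal by (rule bexI[of _ e31]; simp add: mem_X_simps)
  by (rule bexI[of _ e32]; simp add: mem_X_simps)+

lemma not_left_X:
  "\<not> has_left_annihilator X3" "\<not> has_left_annihilator X4" "\<not> has_left_annihilator X6"
  subgoal by (rule no_left_annihilatorI[of "e11 + e22" _ "e11 + e22"]) (auto simp: mem_X_simps)
  subgoal by (rule no_left_annihilatorI[of "e11 + e33" _ e21]) (auto simp: mem_X_simps)
  subgoal by (rule no_left_annihilatorI[of "e11 + e22" _ "e11 + e22"]) (auto simp: mem_X_simps)
  done

lemma not_right_X:
  "\<not> has_right_annihilator X2" "\<not> has_right_annihilator X4" "\<not> has_right_annihilator X7"
  subgoal by (rule no_right_annihilatorI[of e33 _ e32]) (auto simp: mem_X_simps)
  subgoal by (rule no_right_annihilatorI[of "e11 + e33" _ e32]) (auto simp: mem_X_simps)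
  subgoal by (rule no_right_annihilatorI[of "e21 + e22 + e33" _ "e21 + e22 + e33"]) (auto simp: mem_X_simps)
  done

text \<open>The projection to the upper left \<open>2 \<times> 2\<close> block is an isomorphism from \<open>X5\<close>, because the third
  column is zero and the third row repeats the first; the witness is the preimage of the identity
  block.\<close>

lemma unital_X5: "unital X5"
  unfolding unital_def
  by (rule bexI[of _ "e11 + e31 + e22"]) (auto simp: mem_X_simps)

lemma not_unital_X4: "\<not> unital X4"
proof
  assume "unital X4"
  then obtain u where "u \<in> X4" and "\<And>x. x \<in> X4 \<Longrightarrow> x ** u = x"
    by (auto simp: unital_def)
  moreover have "e32 \<in> X4" by (simp add: mem_X_simps)
  ultimately have "u \<in> X4" "e32 ** u = e32" by auto
  then show False by (simp add: mem_X_simps)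
qed

text \<open>The first component splits off \<open>X1\<close>, \<open>X2\<close>, \<open>X6\<close> from the others; within each group the pair and
  balance properties separate everything except \<open>X4\<close> and \<open>X5\<close>, which existence of an identity
  separates.\<close>

lemma distinct_invariants: "distinct (map invariants X_list)"
  using unital_imp_balanced[OF unital_X5]
  by (simp add: X_list_def invariants_def balanced_def corner_X not_corner_X pair_X not_pair_X
      left_X not_left_X right_X not_right_X unital_X5 not_unital_X4)

theorem mainTheorem11:
  shows "(\<forall>S \<in> set X_list. subalgebra S) \<and>
    (\<forall>i < length X_list. \<forall>j < length X_list.
       i \<noteq> j \<longrightarrow> \<not> same_orbit (X_list ! i) (X_list ! j))"
proof (intro conjI allI impI)
  show "\<forall>S \<in> set X_list. subalgebra S"
    by (fact subalgebra_X)
next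
  fix i j
  assume "i < length X_list" "j < length X_list" "i \<noteq> j"
  then have "invariants (X_list ! i) \<noteq> invariants (X_list ! j)"
    using nth_eq_iff_index_eq[OF distinct_invariants, of i j] by simp
  then show "\<not> same_orbit (X_list ! i) (X_list ! j)"
    using invariants_same_orbit by metis
qed

end
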